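(* $(\mathbb R_{>0},\mathrm{ex}_+,\mathrm{ex}_\bullet)$ is a semifield; that is, $\mathrm{ex}_+$ is an associative and commutative operation on $\mathbb R_{>0}$, $\mathrm{ex}_\bullet$ makes $\mathbb R_{>0}$ an abelian group, and $\mathrm{ex}_\bullet$ distributes over $\mathrm{ex}_+$.
   Context: Ordered set means partially ordered set; products carry the componentwise order. $\mathrm{OP}(\mathcal O,\mathcal P)$ is the set of order preserving functions $\mathcal O\to\mathcal P$, ordered pointwise. A partial function $\psi:\mathcal O\rightharpoonup\mathcal P$ is an order preserving function $\psi:\mathrm{dom}(\psi)\to\mathcal P$ defined on a subset $\mathrm{dom}(\psi)\subseteq\mathcal O$ with the induced order. An extension of $\psi$ to $\mathcal O$ is an order preserving function $f:\mathcal O\to\mathcal P$ restricting to $\psi$ on $\mathrm{dom}(\psi)$. $\psi$ is extremizable if there exist extensions $\mathrm{lex}_\psi,\mathrm{uex}_\psi:\mathcal O\to\mathcal P$ of $\psi$ with $\mathrm{lex}_\psi\le f\le\mathrm{uex}_\psi$ pointwise for every extension $f$. Then $\mathrm{Dar}(\psi)=\{x\in\mathcal O\mid\mathrm{lex}_\psi(x)=\mathrm{uex}_\psi(x)\}$ and $\mathrm{ex}_\psi$ is the common restriction of $\mathrm{lex}_\psi$ and $\mathrm{uex}_\psi$ to $\mathrm{Dar}(\psi)$. For an ordered set $\mathcal O$ let $\mathcal O^\vee=\mathrm{OP}(\mathcal O^{\mathrm{op}},\{-\infty<+\infty\})$ and let $Y:\mathcal O\to\mathcal O^\vee$ be the Yoneda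 embedding: $Y(x)(y)=+\infty$ if $y\le x$ and $Y(x)(y)=-\infty$ otherwise. Let $\varphi:\mathcal O^\vee\rightharpoonup\mathcal O^\vee$ be the partial function with domain $Y(\mathcal O)$ given by the identity (it is extremizable), and let $\mathrm{Dar}(\mathcal O)$ be its Darboux set, which has a least and a greatest element. The Darboux completion $\mathrm{Dar}'(\mathcal O)$ is $\mathrm{Dar}(\mathcal O)$ with its least and greatest elements removed. Define $\mathbb R=\mathrm{Dar}'(\mathbb Q)$ and $\mathbb R_{>0}=\mathrm{Dar}'(\mathbb Q_{>0})$, where $\mathbb Q_{>0}$ is the ordered set of positive rationals. $\mathbb Q$ and $\mathbb Q_{>0}$ are identified with their images under $Y$. Extending each function in $\mathrm{Dar}'(\mathbb Q_{>0})$ by $+\infty$ on $\mathbb Q\setminus\mathbb Q_{>0}$ identifies $\mathbb R_{>0}$ with $\{x\in\mathbb R\mid x>Y(0)\}$, compatibly with $\mathbb Q_{>0}\subseteq\mathbb Q$. The operation $+$ is the addition of $\mathbb Q$ regarded as a partial function $\mathbb R\times\mathbb R\rightharpoonup\mathbb R$ with domain $\mathbb Q\times\mathbb Q$; $\bullet$ is the multiplication of $\mathbb Q_{>0}$ regarded as a partial function $\mathbb R_{>0}\times\mathbb R_{>0}\rightharpoonup\mathbb R_{>0}$ with domain $\mathbb Q_{>0}\times\mathbb Q_{>0}$. Both are extremizable, and their Darboux extensions $\mathrm{ex}_+$ and $\mathrm{ex}_\bullet$ are everywhere defined (on $\mathbb R\times\mathbb R$ and $\mathbb R_{>0}\times\mathbb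 R_{>0}$ respectively); in the claim $\mathrm{ex}_+$ is restricted to $\mathbb R_{>0}$. *)

theory Defs
  imports Complex_Main "HOL-Library.FuncSet" "HOL-Library.Product_Order" "HOL-Algebra.Group"
begin

text \<open>
  An ordered set is a set \<open>X :: 'a::order set\<close> with the order induced from its type. Pairs are
  ordered componentwise (theory \<open>Product_Order\<close>), functions pointwise.
\<close>

definition OP :: "'a::order set \<Rightarrow> 'b::order set \<Rightarrow> ('a \<Rightarrow> 'b) set" where
  "OP X P = {f \<in> X \<rightarrow>\<^sub>E P. mono_on X f}"

definition partial_OP :: "'a::order set \<Rightarrow> 'b::order set \<Rightarrow> ('a \<rightharpoonup> 'b) \<Rightarrow> bool" where
  "partial_OP X P \<psi> \<longleftrightarrow>
     dom \<psi> \<subseteq> X \<and> ran \<psi> \<subseteq> P \<and> mono_on (dom \<psi>) (\<lambda>x. the (\<psi> x))"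

definition extensions :: "'a::order set \<Rightarrow> 'b::order set \<Rightarrow> ('a \<rightharpoonup> 'b) \<Rightarrow> ('a \<Rightarrow> 'b) set" where
  "extensions X P \<psi> = {f \<in> OP X P. \<forall>x \<in> dom \<psi>. \<psi> x = Some (f x)}"

definition is_lex :: "'a::order set \<Rightarrow> 'b::order set \<Rightarrow> ('a \<rightharpoonup> 'b) \<Rightarrow> ('a \<Rightarrow> 'b) \<Rightarrow> bool" where
  "is_lex X P \<psi> l \<longleftrightarrow>
     l \<in> extensions X P \<psi> \<and> (\<forall>f \<in> extensions X P \<psi>. \<forall>x \<in> X. l x \<le> f x)"

definition is_uex :: "'a::order set \<Rightarrow> 'b::order set \<Rightarrow> ('a \<rightharpoonup> 'b) \<Rightarrow> ('a \<Rightarrow> 'b) \<Rightarrow> bool" where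
  "is_uex X P \<psi> u \<longleftrightarrow>
     u \<in> extensions X P \<psi> \<and> (\<forall>f \<in> extensions X P \<psi>. \<forall>x \<in> X. f x \<le> u x)"

definition extremizable :: "'a::order set \<Rightarrow> 'b::order set \<Rightarrow> ('a \<rightharpoonup> 'b) \<Rightarrow> bool" where
  "extremizable X P \<psi> \<longleftrightarrow>
     partial_OP X P \<psi> \<and> (\<exists>l. is_lex X P \<psi> l) \<and> (\<exists>u. is_uex X P \<psi> u)"

definition lex_ext :: "'a::order set \<Rightarrow> 'b::order set \<Rightarrow> ('a \<rightharpoonup> 'b) \<Rightarrow> 'a \<Rightarrow> 'b" where
  "lex_ext X P \<psi> = (THE l. is_lex X P \<psi> l)"

definition uex_ext :: "'a::order set \<Rightarrow> 'b::order set \<Rightarrow> ('a \<rightharpoonup> 'b) \<Rightarrow> 'a \<Rightarrow> 'b" where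
  "uex_ext X P \<psi> = (THE u. is_uex X P \<psi> u)"

text \<open>The Darboux set only makes sense for extremizable \<open>\<psi>\<close>; by convention it is empty otherwise.\<close>

definition Dar :: "'a::order set \<Rightarrow> 'b::order set \<Rightarrow> ('a \<rightharpoonup> 'b) \<Rightarrow> 'a set" where
  "Dar X P \<psi> = {x \<in> X. extremizable X P \<psi> \<and> lex_ext X P \<psi> x = uex_ext X P \<psi> x}"

definition darboux_ext :: "'a::order set \<Rightarrow> 'b::order set \<Rightarrow> ('a \<rightharpoonup> 'b) \<Rightarrow> ('a \<rightharpoonup> 'b)" where
  "darboux_ext X P \<psi> = (\<lambda>x. if x \<in> Dar X P \<psi> then Some (lex_ext X P \<psi> x) else None)"

text \<open>
  The ordered set \<open>{-\<infinity> < +\<infinity>}\<close> is \<^typ>\<open>bool\<close>, with \<open>-\<infinity> = False\<close> and \<open>+\<infinity> = True\<close>.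
  An order preserving function from the opposite of \<open>X\<close> to it, a priori defined only on
  \<open>X\<close>, is represented by its extension by \<open>+\<infinity>\<close> to the whole type. The value off \<open>X\<close> is
  irrelevant for the order among such functions; with this choice the identification
  of the Darboux completion of the positive rationals with the elements \<open>> Y 0\<close> of the
  Darboux completion of the rationals (extension by \<open>+\<infinity>\<close>) is the identity.
\<close>

definition vee :: "'a::order set \<Rightarrow> ('a \<Rightarrow> bool) set" where
  "vee X = {u. antimono_on X u \<and> (\<forall>y. y \<notin> X \<longrightarrow> u y = True)}"

definition yoneda :: "'a::order set \<Rightarrow> 'a \<Rightarrow> ('a \<Rightarrow> bool)" where
  "yoneda X x = (\<lambda>y. if y \<in> X then y \<le> x else True)"

definition Darboux_set :: "'a::order set \<Rightarrow> ('a \<Rightarrow> bool) set" where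
  "Darboux_set X = Dar (vee X) (vee X) (Some |` (yoneda X ` X))"

definition Darboux_completion :: "'a::order set \<Rightarrow> ('a \<Rightarrow> bool) set" where
  "Darboux_completion X =
     {u \<in> Darboux_set X. \<not> (\<forall>v \<in> Darboux_set X. u \<le> v) \<and> \<not> (\<forall>v \<in> Darboux_set X. v \<le> u)}"

definition yoneda_op ::
  "'a::order set \<Rightarrow> ('a \<Rightarrow> 'a \<Rightarrow> 'a) \<Rightarrow> (('a \<Rightarrow> bool) \<times> ('a \<Rightarrow> bool) \<rightharpoonup> ('a \<Rightarrow> bool))" where
  "yoneda_op X f = (\<lambda>(u, v).
     if u \<in> yoneda X ` X \<and> v \<in> yoneda X ` X
     then Some (yoneda X (f (the_inv_into X (yoneda X) u) (the_inv_into X (yoneda X) v)))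
     else None)"

definition Qpos :: "rat set" where
  "Qpos = {q. 0 < q}"

definition DR :: "(rat \<Rightarrow> bool) set" where
  "DR = Darboux_completion (UNIV :: rat set)"

definition DRpos :: "(rat \<Rightarrow> bool) set" where
  "DRpos = Darboux_completion Qpos"

definition ex_plus :: "(rat \<Rightarrow> bool) \<times> (rat \<Rightarrow> bool) \<rightharpoonup> (rat \<Rightarrow> bool)" where
  "ex_plus = darboux_ext (DR \<times> DR) DR (yoneda_op UNIV (+))"

definition ex_times :: "(rat \<Rightarrow> bool) \<times> (rat \<Rightarrow> bool) \<rightharpoonup> (rat \<Rightarrow> bool)" where
  "ex_times = darboux_ext (DRpos \<times> DRpos) DRpos (yoneda_op Qpos (*))"

text \<open>
  A partial binary function is an operation on \<open>S\<close> if it is defined on all of \<open>S \<times> S\<close>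
  with values in \<open>S\<close>; only its restriction to \<open>S \<times> S\<close> matters below.
\<close>

definition operation_on :: "'a set \<Rightarrow> ('a \<times> 'a \<rightharpoonup> 'a) \<Rightarrow> bool" where
  "operation_on S f \<longleftrightarrow> (\<forall>x\<in>S. \<forall>y\<in>S. \<exists>z\<in>S. f (x, y) = Some z)"

definition app2 :: "('a \<times> 'a \<rightharpoonup> 'a) \<Rightarrow> 'a \<Rightarrow> 'a \<Rightarrow> 'a" where
  "app2 f x y = the (f (x, y))"

definition semifield :: "'a set \<Rightarrow> ('a \<times> 'a \<rightharpoonup> 'a) \<Rightarrow> ('a \<times> 'a \<rightharpoonup> 'a) \<Rightarrow> bool" where
  "semifield S p t \<longleftrightarrow>
     operation_on S p \<and>
     (\<forall>x\<in>S. \<forall>y\<in>S. \<forall>z\<in>S. app2 p (app2 p x y) z = app2 p x (app2 p y z)) \<and>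
     (\<forall>x\<in>S. \<forall>y\<in>S. app2 p x y = app2 p y x) \<and>
     operation_on S t \<and>
     (\<exists>e. comm_group \<lparr>carrier = S, mult = app2 t, one = e\<rparr>) \<and>
     (\<forall>x\<in>S. \<forall>y\<in>S. \<forall>z\<in>S. app2 t x (app2 p y z) = app2 p (app2 t x y) (app2 t x z)) \<and>
     (\<forall>x\<in>S. \<forall>y\<in>S. \<forall>z\<in>S. app2 t (app2 p x y) z = app2 p (app2 t x z) (app2 t y z))"

end

theory Submission imports Defs begin

text \<open>
  The two Darboux completions are sets of Dedekind cuts, and the Darboux extensions of the
  rational operations are the real ones, so the laws can be read off from the field of reals.

  For any ordered set \<open>X\<close>, the least extension of the identity of \<open>Y(X)\<close> to the down-sets of \<open>X\<close>
  is the identity, and the greatest one sends a down-set to the set of lower bounds of its upper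
  bounds. The Darboux set is therefore the Dedekind--MacNeille completion of \<open>X\<close>
  (\<open>Darboux_set_eq_closed\<close>). If \<open>X\<close> is a nonempty up-set of rationals without a minimum, its
  closed down-sets other than \<open>{}\<close> and \<open>X\<close> are the cuts \<open>{q \<in> X. q \<le> r}\<close> at the reals \<open>r\<close>
  strictly above some element of \<open>X\<close> (\<open>Darboux_completion_eq_cuts\<close>). This covers both \<open>\<rat>\<close> and
  its positive part, and it matches \<open>DR\<close> and \<open>DRpos\<close> with the reals and the positive reals.

  An order preserving extension of a rational operation is squeezed at a pair of reals between
  its values at rational pairs below and above. For addition and multiplication these
  values leave room for the real sum or product only. Hence the extension is unique, it is
  automatically both least and greatest, and its Darboux set is everything
  (\<open>darboux_ext_cut\<close>). So \<open>ex_plus\<close> and \<open>ex_times\<close> are real addition and multiplication, and the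
  semifield laws are inherited from the reals.
\<close>

section \<open>Least and greatest extensions\<close>

text \<open>
  Functions in \<open>OP X P\<close> take the value \<open>undefined\<close> off \<open>X\<close>; this is what makes a least extension
  unique as a total function, so that the definite descriptions denote.
\<close>

lemma lex_ext_eqI:
  assumes "is_lex X P \<psi> l"
  shows "lex_ext X P \<psi> = l"
  unfolding lex_ext_def
proof (rule the_equality)
  show "is_lex X P \<psi> l" by fact
next
  fix l' assume l': "is_lex X P \<psi> l'"
  have "l' \<in> X \<rightarrow>\<^sub>E P" "l \<in> X \<rightarrow>\<^sub>E P"
    using assms l' by (auto simp: is_lex_def extensions_def OP_def)
  moreover have "l' x = l x" if "x \<in> X" for x
    using assms l' that by (auto simp: is_lex_def intro: order_antisym)
  ultimately show "l' = l" by (rule PiE_ext)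
qed

lemma uex_ext_eqI:
  assumes "is_uex X P \<psi> u"
  shows "uex_ext X P \<psi> = u"
  unfolding uex_ext_def
proof (rule the_equality)
  show "is_uex X P \<psi> u" by fact
next
  fix u' assume u': "is_uex X P \<psi> u'"
  have "u' \<in> X \<rightarrow>\<^sub>E P" "u \<in> X \<rightarrow>\<^sub>E P"
    using assms u' by (auto simp: is_uex_def extensions_def OP_def)
  moreover have "u' x = u x" if "x \<in> X" for x
    using assms u' that by (auto simp: is_uex_def intro: order_antisym)
  ultimately show "u' = u" by (rule PiE_ext)
qed

lemma Dar_eqI:
  assumes "partial_OP X P \<psi>" "is_lex X P \<psi> l" "is_uex X P \<psi> u"
  shows "Dar X P \<psi> = {x \<in> X. l x = u x}"
  using assms by (auto simp: Dar_def extremizable_def lex_ext_eqI uex_ext_eqI)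

lemma darboux_ext_unique:
  assumes "partial_OP X P \<psi>" and g: "g \<in> extensions X P \<psi>"
    and unique: "\<And>f x. f \<in> extensions X P \<psi> \<Longrightarrow> x \<in> X \<Longrightarrow> f x = g x"
    and "x \<in> X"
  shows "darboux_ext X P \<psi> x = Some (g x)"
proof -
  have l: "is_lex X P \<psi> g" and u: "is_uex X P \<psi> g"
    using g unique by (auto simp: is_lex_def is_uex_def)
  show ?thesis
    using Dar_eqI[OF assms(1) l u] lex_ext_eqI[OF l] \<open>x \<in> X\<close> by (simp add: darboux_ext_def)
qed

section \<open>The Darboux set as Dedekind--MacNeille completion\<close>

text \<open>
  The lower bounds in \<open>X\<close> of the upper bounds in \<open>X\<close> of the down-set \<open>u\<close>, with the value \<open>True\<close>
  off \<open>X\<close> that membership in \<open>vee X\<close> requires.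
\<close>

definition closure_vee :: "'a::order set \<Rightarrow> ('a \<Rightarrow> bool) \<Rightarrow> ('a \<Rightarrow> bool)" where
  "closure_vee X u = (\<lambda>y. y \<in> X \<longrightarrow> (\<forall>z\<in>X. (\<forall>w\<in>X. u w \<longrightarrow> w \<le> z) \<longrightarrow> y \<le> z))"

lemma vee_downward: "u \<in> vee X \<Longrightarrow> x \<in> X \<Longrightarrow> y \<in> X \<Longrightarrow> x \<le> y \<Longrightarrow> u y \<Longrightarrow> u x"
  by (auto simp: vee_def monotone_on_def)

lemma yoneda_in_vee: "yoneda X x \<in> vee X"
  by (auto simp: vee_def yoneda_def monotone_on_def intro: order_trans)

lemma yoneda_le_iff:
  assumes "u \<in> vee X" "x \<in> X"
  shows "yoneda X x \<le> u \<longleftrightarrow> u x"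
  using assms vee_downward[OF assms(1)]
  by (auto simp: le_fun_def yoneda_def vee_def)

lemma le_yoneda_iff: "u \<le> yoneda X x \<longleftrightarrow> (\<forall>w\<in>X. u w \<longrightarrow> w \<le> x)"
  by (auto simp: le_fun_def yoneda_def)

lemma closure_vee_in_vee: "closure_vee X u \<in> vee X"
  by (auto simp: vee_def closure_vee_def monotone_on_def)

lemma closure_vee_mono: "u \<le> v \<Longrightarrow> closure_vee X u \<le> closure_vee X v"
  by (auto simp: closure_vee_def le_fun_def)

lemma closure_vee_yoneda: "x \<in> X \<Longrightarrow> closure_vee X (yoneda X x) = yoneda X x"
  by (fastforce simp: closure_vee_def yoneda_def fun_eq_iff intro: order_trans)

lemma le_closure_vee: "u \<in> vee X \<Longrightarrow> u \<le> closure_vee X u"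
  by (auto simp: closure_vee_def le_fun_def)

lemma yoneda_inj_on: "inj_on (yoneda X) X"
proof (rule inj_onI)
  fix x y assume "x \<in> X" "y \<in> X" "yoneda X x = yoneda X y"
  then show "x = y"
    by (metis order_antisym order_refl yoneda_def)
qed

text \<open>
  Every down-set is a union of principal ones and its closure is an intersection of principal
  ones, while an extension has to fix each principal down-set. So its value at \<open>u\<close> contains
  \<open>u\<close> and is contained in the closure of \<open>u\<close>, and both bounds are attained.
\<close>

lemma Darboux_set_eq_closed: "Darboux_set X = {u \<in> vee X. closure_vee X u = u}"
proof -
  let ?\<psi> = "Some |` (yoneda X ` X)"
  let ?I = "restrict (\<lambda>u. u) (vee X)" and ?C = "restrict (closure_vee X) (vee X)"
  have partial: "partial_OP (vee X) (vee X) ?\<psi>"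
    by (auto simp: partial_OP_def ran_def restrict_map_def monotone_on_def yoneda_in_vee
        split: if_splits)
  have ext_iff: "f \<in> extensions (vee X) (vee X) ?\<psi> \<longleftrightarrow>
      f \<in> vee X \<rightarrow>\<^sub>E vee X \<and> mono_on (vee X) f \<and> (\<forall>x\<in>X. f (yoneda X x) = yoneda X x)" for f
    by (auto simp: extensions_def OP_def)
  have I: "?I \<in> extensions (vee X) (vee X) ?\<psi>"
    unfolding ext_iff by (auto simp: monotone_on_def yoneda_in_vee)
  have C: "?C \<in> extensions (vee X) (vee X) ?\<psi>"
    unfolding ext_iff
    by (auto simp: monotone_on_def closure_vee_in_vee closure_vee_mono closure_vee_yoneda
        yoneda_in_vee)
  have lower: "u \<le> f u" and upper: "f u \<le> closure_vee X u"
    if f: "f \<in> extensions (vee X) (vee X) ?\<psi>" and u: "u \<in> vee X" for f u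
  proof -
    have fu: "f u \<in> vee X" and mono: "\<And>v w. v \<in> vee X \<Longrightarrow> w \<in> vee X \<Longrightarrow> v \<le> w \<Longrightarrow> f v \<le> f w"
      and fix_yoneda: "\<And>x. x \<in> X \<Longrightarrow> f (yoneda X x) = yoneda X x"
      using f u unfolding ext_iff by (auto simp: monotone_on_def)
    show "u \<le> f u"
    proof (rule le_funI, rule le_boolI)
      fix x assume "u x"
      show "f u x"
      proof (cases "x \<in> X")
        case True
        then have "yoneda X x \<le> u" using yoneda_le_iff[OF u] \<open>u x\<close> by simp
        then have "yoneda X x \<le> f u"
          using mono[OF yoneda_in_vee u] fix_yoneda[OF True] by fastforce
        then show ?thesis using yoneda_le_iff[OF fu True] by simp
      qed (use fu in \<open>auto simp: vee_def\<close>)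
    qed
    show "f u \<le> closure_vee X u"
    proof -
      have "y \<le> z" if "f u y" "y \<in> X" "z \<in> X" "\<forall>w\<in>X. u w \<longrightarrow> w \<le> z" for y z
      proof -
        have "u \<le> yoneda X z" using that(4) by (simp add: le_yoneda_iff)
        then have "f u \<le> yoneda X z"
          using mono[OF u yoneda_in_vee] fix_yoneda[OF that(3)] by fastforce
        then show ?thesis using that(1,2) by (simp add: le_yoneda_iff)
      qed
      then show ?thesis by (auto simp: closure_vee_def le_fun_def)
    qed
  qed
  have "is_lex (vee X) (vee X) ?\<psi> ?I" "is_uex (vee X) (vee X) ?\<psi> ?C"
    using I C lower upper by (auto simp: is_lex_def is_uex_def)
  from Dar_eqI[OF partial this] show ?thesis
    by (auto simp: Darboux_set_def)
qed

section \<open>Dedekind cuts\<close>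

definition cut :: "real \<Rightarrow> rat \<Rightarrow> bool" where
  "cut r = (\<lambda>q. of_rat q \<le> r)"

lemma cut_le_cut_iff: "cut r \<le> cut s \<longleftrightarrow> r \<le> s"
proof
  assume "cut r \<le> cut s"
  show "r \<le> s"
  proof (rule ccontr)
    assume "\<not> r \<le> s"
    then obtain q where "s < of_rat q" "of_rat q < r" using of_rat_dense[of s r] by auto
    then show False using \<open>cut r \<le> cut s\<close> by (auto simp: cut_def le_fun_def dest!: spec[of _ q])
  qed
qed (auto simp: cut_def le_fun_def)

lemma cut_eq_cut_iff: "cut r = cut s \<longleftrightarrow> r = s"
  using cut_le_cut_iff by (metis order_antisym order_refl)

text \<open>
  The up-sets of rationals without a minimum include both \<open>\<rat>\<close> and its positive part. Being an
  up-set makes the default value \<open>True\<close> off \<open>X\<close> agree with the cut, and having no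
  minimum makes the empty down-set closed, so that it is the least element of the Darboux set.
\<close>

lemma Darboux_completion_eq_cuts:
  fixes X :: "rat set"
  assumes nonempty: "X \<noteq> {}"
    and up: "\<And>x y. x \<in> X \<Longrightarrow> x \<le> y \<Longrightarrow> y \<in> X"
    and no_min: "\<And>x. x \<in> X \<Longrightarrow> \<exists>y\<in>X. y < x"
  shows "Darboux_completion X = cut ` {r. \<exists>x\<in>X. of_rat x < r}"
proof -
  have bot: "(\<lambda>y. y \<notin> X) \<in> Darboux_set X"
    using no_min by (force simp: Darboux_set_eq_closed vee_def closure_vee_def monotone_on_def
        fun_eq_iff not_le)
  have no_max: "\<exists>y\<in>X. x < y" if "x \<in> X" for x
    using up[OF that, of "x + 1"] by (intro bexI[of _ "x + 1"]) auto
  have top: "(\<lambda>_. True) \<in> Darboux_set X"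
    using no_max by (fastforce simp: Darboux_set_eq_closed vee_def closure_vee_def monotone_on_def
        fun_eq_iff not_le)
  have least: "(\<forall>v\<in>Darboux_set X. u \<le> v) \<longleftrightarrow> (\<forall>x\<in>X. \<not> u x)" if "u \<in> Darboux_set X" for u
    using bot that by (auto simp: le_fun_def Darboux_set_eq_closed vee_def)
  have greatest: "(\<forall>v\<in>Darboux_set X. v \<le> u) \<longleftrightarrow> (\<forall>x\<in>X. u x)" if "u \<in> Darboux_set X" for u
    using top that by (auto simp: le_fun_def Darboux_set_eq_closed vee_def)
  have completion: "u \<in> Darboux_completion X \<longleftrightarrow>
      u \<in> vee X \<and> closure_vee X u = u \<and> (\<exists>x\<in>X. u x) \<and> (\<exists>x\<in>X. \<not> u x)" for u
    using least[of u] greatest[of u] by (auto simp: Darboux_completion_def Darboux_set_eq_closed)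
  show ?thesis
  proof (intro equalityI subsetI)
    fix u assume "u \<in> Darboux_completion X"
    then obtain a b where u: "u \<in> vee X" "closure_vee X u = u" and a: "a \<in> X" "u a"
      and b: "b \<in> X" "\<not> u b"
      using completion by auto
    let ?A = "of_rat ` {x \<in> X. u x} :: real set"
    define r where "r = Sup ?A"
    have "x \<le> b" if "x \<in> X" "u x" for x
      using vee_downward[OF u(1), of b x] that b by (meson linear)
    then have bdd: "bdd_above ?A"
      by (intro bdd_aboveI[of _ "of_rat b"]) (auto simp: of_rat_less_eq)
    have le_r: "of_rat x \<le> r" if "x \<in> X" "u x" for x
      unfolding r_def using bdd that by (auto intro: cSup_upper)
    have "u y = cut r y" for y
    proof (cases "y \<in> X")
      case True
      have "u y" if y: "of_rat y \<le> r"
      proof -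
        have "y \<le> z" if "\<forall>w\<in>X. u w \<longrightarrow> w \<le> z" for z
        proof -
          have "r \<le> of_rat z"
            unfolding r_def using a that by (intro cSup_least) (auto simp: of_rat_less_eq)
          with y have "(of_rat y :: real) \<le> of_rat z" by linarith
          then show ?thesis by (simp add: of_rat_less_eq)
        qed
        then have "closure_vee X u y" by (auto simp: closure_vee_def)
        then show ?thesis using u(2) by simp
      qed
      then show ?thesis using le_r True by (auto simp: cut_def)
    next
      case False
      then have "y \<le> a" using up[OF a(1), of y] by linarith
      then have "(of_rat y :: real) \<le> of_rat a" by (simp add: of_rat_less_eq)
      then show ?thesis using False u(1) le_r[OF a] by (auto simp: cut_def vee_def)
    qed
    moreover obtain c where "c \<in> X" "c < a" using no_min a by blast
    then have "of_rat c < r" using le_r[OF a] by (meson of_rat_less order_less_le_trans)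
    ultimately show "u \<in> cut ` {r. \<exists>x\<in>X. of_rat x < r}"
      using \<open>c \<in> X\<close> by (intro image_eqI[of _ _ r]) auto
  next
    fix u assume "u \<in> cut ` {r. \<exists>x\<in>X. of_rat x < r}"
    then obtain r x where u: "u = cut r" and x: "x \<in> X" "of_rat x < r" by auto
    have in_X: "q \<in> X" if "r < of_rat q" for q
    proof -
      have "(of_rat x :: real) < of_rat q" using x that by linarith
      then show ?thesis using up[OF x(1), of q] by (simp add: of_rat_less)
    qed
    have off_X: "of_rat q \<le> r" if "q \<notin> X" for q
      using in_X that by (meson not_le)
    have vee: "u \<in> vee X"
    proof -
      have "of_rat p \<le> r" if "p \<le> q" "of_rat q \<le> r" for p q
        using that by (meson of_rat_less_eq order_trans)
      then show ?thesis using off_X by (auto simp: u vee_def cut_def monotone_on_def)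
    qed
    moreover have "closure_vee X u = u"
    proof (rule order_antisym[OF _ le_closure_vee[OF vee]], rule le_funI, rule le_boolI, rule ccontr)
      fix y assume y: "closure_vee X u y" "\<not> u y"
      then have "r < of_rat y" by (simp add: u cut_def)
      from of_rat_dense[OF this] obtain z where z: "r < of_rat z" "of_rat z < (of_rat y :: real)"
        by auto
      have "w \<le> z" if "u w" for w
        using that z(1) by (metis cut_def linear of_rat_less_eq order.strict_trans2 not_le u)
      then have "y \<le> z"
        using y(1) in_X[OF z(1)] in_X[OF \<open>r < of_rat y\<close>] by (auto simp: closure_vee_def)
      then show False using z(2) by (simp add: of_rat_less)
    qed
    moreover have "u x" using x by (simp add: u cut_def)
    moreover obtain q where "r < of_rat q" using of_rat_dense[of r "r + 1"] by auto
    then have "q \<in> X" "\<not> u q" using in_X by (auto simp: u cut_def)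
    ultimately show "u \<in> Darboux_completion X" using x(1) completion by blast
  qed
qed

lemma DR_eq_cuts: "DR = range cut"
proof -
  have "\<exists>x. of_rat x < r" for r :: real
    using of_rat_dense[of "r - 1" r] by auto
  moreover have "\<exists>y. y < x" for x :: rat
    by (rule exI[of _ "x - 1"]) simp
  ultimately show ?thesis
    by (simp add: DR_def Darboux_completion_eq_cuts)
qed

lemma Qpos_iff: "x \<in> Qpos \<longleftrightarrow> 0 < x"
  by (simp add: Qpos_def)

lemma DRpos_eq_cuts: "DRpos = cut ` {0<..}"
proof -
  have "(\<exists>x\<in>Qpos. of_rat x < r) \<longleftrightarrow> 0 < r" for r :: real
  proof
    assume "0 < r"
    then show "\<exists>x\<in>Qpos. of_rat x < r"
      using of_rat_dense[of 0 r] by (auto simp: Qpos_iff)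
  next
    assume "\<exists>x\<in>Qpos. of_rat x < r"
    then obtain x :: rat where "0 < x" "of_rat x < r" by (auto simp: Qpos_iff)
    then show "0 < r" using zero_less_of_rat_iff[of x, where ?'a = real] by linarith
  qed
  moreover have "\<exists>y\<in>Qpos. y < x" if "x \<in> Qpos" for x
    using that by (intro bexI[of _ "x / 2"]) (auto simp: Qpos_iff)
  moreover have "Qpos \<noteq> {}" using Qpos_iff[of 1] by auto
  ultimately show ?thesis
    unfolding DRpos_def by (subst Darboux_completion_eq_cuts) (auto simp: Qpos_iff greaterThan_def)
qed

lemma yoneda_UNIV: "yoneda UNIV x = cut (of_rat x)"
  by (simp add: yoneda_def cut_def of_rat_less_eq)

lemma yoneda_Qpos: "x \<in> Qpos \<Longrightarrow> yoneda Qpos x = cut (of_rat x)"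
  by (auto simp: yoneda_def cut_def of_rat_less_eq Qpos_iff fun_eq_iff)

section \<open>Darboux extensions of rational operations\<close>

lemma yoneda_op_yoneda:
  "x \<in> X \<Longrightarrow> y \<in> X \<Longrightarrow> yoneda_op X f (yoneda X x, yoneda X y) = Some (yoneda X (f x y))"
  by (simp add: yoneda_op_def the_inv_into_f_f[OF yoneda_inj_on])

text \<open>
  The hypotheses \<open>below\<close> and \<open>above\<close> are what continuity of the real operation \<open>F\<close> provides: its
  value at a pair of reals is approximated from either side by values of \<open>f\<close> at rational pairs on
  that side. An order preserving extension is then forced to take the value \<open>F r s\<close>.
\<close>

lemma darboux_ext_cut:
  fixes X :: "rat set" and S :: "real set" and f :: "rat \<Rightarrow> rat \<Rightarrow> rat" and F :: "real \<Rightarrow> real \<Rightarrow> real"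
  assumes yoneda: "\<And>x. x \<in> X \<Longrightarrow> yoneda X x = cut (of_rat x)"
    and X_S: "\<And>x. x \<in> X \<Longrightarrow> of_rat x \<in> S"
    and f_closed: "\<And>x y. x \<in> X \<Longrightarrow> y \<in> X \<Longrightarrow> f x y \<in> X"
    and F_closed: "\<And>r s. r \<in> S \<Longrightarrow> s \<in> S \<Longrightarrow> F r s \<in> S"
    and F_f: "\<And>x y. x \<in> X \<Longrightarrow> y \<in> X \<Longrightarrow> F (of_rat x) (of_rat y) = of_rat (f x y)"
    and F_mono: "\<And>r s r' s'. r \<in> S \<Longrightarrow> s \<in> S \<Longrightarrow> r' \<in> S \<Longrightarrow> s' \<in> S \<Longrightarrow> r \<le> r' \<Longrightarrow> s \<le> s' \<Longrightarrow>
      F r s \<le> F r' s'"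
    and below: "\<And>r s t. r \<in> S \<Longrightarrow> s \<in> S \<Longrightarrow> t \<in> S \<Longrightarrow> t < F r s \<Longrightarrow>
      \<exists>p\<in>X. \<exists>q\<in>X. of_rat p \<le> r \<and> of_rat q \<le> s \<and> t < of_rat (f p q)"
    and above: "\<And>r s t. r \<in> S \<Longrightarrow> s \<in> S \<Longrightarrow> t \<in> S \<Longrightarrow> F r s < t \<Longrightarrow>
      \<exists>p\<in>X. \<exists>q\<in>X. r \<le> of_rat p \<and> s \<le> of_rat q \<and> of_rat (f p q) < t"
    and "r \<in> S" "s \<in> S"
  shows "darboux_ext (cut ` S \<times> cut ` S) (cut ` S) (yoneda_op X f) (cut r, cut s) =
    Some (cut (F r s))"
proof -
  let ?C = "cut ` S" and ?\<psi> = "yoneda_op X f"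
  have psi: "?\<psi> (cut (of_rat x), cut (of_rat y)) = Some (cut (of_rat (f x y)))"
    if "x \<in> X" "y \<in> X" for x y
    using yoneda_op_yoneda[OF that, of f] by (simp add: yoneda f_closed that)
  have dom: "dom ?\<psi> = (\<lambda>(x, y). (cut (of_rat x), cut (of_rat y))) ` (X \<times> X)"
  proof -
    have "dom ?\<psi> = yoneda X ` X \<times> yoneda X ` X"
      by (auto simp: yoneda_op_def dom_def split: if_splits)
    also have "yoneda X ` X = (\<lambda>x. cut (of_rat x)) ` X"
      using yoneda by auto
    finally show ?thesis by (simp add: image_paired_Times)
  qed
  define g where "g = restrict (\<lambda>(u, v). cut (F (the_inv cut u) (the_inv cut v))) (?C \<times> ?C)"
  have "inj cut" by (simp add: inj_def cut_eq_cut_iff)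
  then have g: "g (cut a, cut b) = cut (F a b)" if "a \<in> S" "b \<in> S" for a b
    using that by (auto simp: g_def the_inv_f_f)
  have partial: "partial_OP (?C \<times> ?C) ?C ?\<psi>"
    unfolding partial_OP_def
  proof (intro conjI)
    show "dom ?\<psi> \<subseteq> ?C \<times> ?C" using X_S by (auto simp: dom)
    show "ran ?\<psi> \<subseteq> ?C"
    proof
      fix w assume "w \<in> ran ?\<psi>"
      then obtain z where z: "?\<psi> z = Some w" by (auto simp: ran_def)
      then have "z \<in> dom ?\<psi>" by auto
      then show "w \<in> ?C" using z psi X_S f_closed by (auto simp: dom)
    qed
    show "mono_on (dom ?\<psi>) (\<lambda>x. the (?\<psi> x))"
    proof (rule monotone_onI)
      fix z z' assume "z \<in> dom ?\<psi>" "z' \<in> dom ?\<psi>" "z \<le> z'"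
      then obtain a b a' b' where X: "a \<in> X" "b \<in> X" "a' \<in> X" "b' \<in> X"
        and z: "z = (cut (of_rat a), cut (of_rat b))" "z' = (cut (of_rat a'), cut (of_rat b'))"
        by (auto simp: dom)
      have "F (of_rat a) (of_rat b) \<le> F (of_rat a') (of_rat b')"
        using \<open>z \<le> z'\<close> X X_S by (intro F_mono) (auto simp: z cut_le_cut_iff)
      then show "the (?\<psi> z) \<le> the (?\<psi> z')" by (simp add: z X psi F_f cut_le_cut_iff)
    qed
  qed
  have ext: "g \<in> extensions (?C \<times> ?C) ?C ?\<psi>"
    unfolding extensions_def OP_def
  proof (intro CollectI conjI ballI)
    show "g \<in> ?C \<times> ?C \<rightarrow>\<^sub>E ?C"
    proof (rule PiE_I)
      fix z assume "z \<in> ?C \<times> ?C"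
      then show "g z \<in> ?C" using F_closed by (auto simp: g)
    qed (simp add: g_def)
    show "mono_on (?C \<times> ?C) g"
    proof (rule monotone_onI)
      fix z z' assume "z \<in> ?C \<times> ?C" "z' \<in> ?C \<times> ?C" "z \<le> z'"
      then obtain a b a' b' where S: "a \<in> S" "b \<in> S" "a' \<in> S" "b' \<in> S"
        and z: "z = (cut a, cut b)" "z' = (cut a', cut b')"
        by auto
      have "F a b \<le> F a' b'"
        using \<open>z \<le> z'\<close> S by (intro F_mono) (auto simp: z cut_le_cut_iff)
      then show "g z \<le> g z'" by (simp add: z S g cut_le_cut_iff)
    qed
    show "?\<psi> z = Some (g z)" if "z \<in> dom ?\<psi>" for z
      using that X_S by (auto simp: dom psi g F_f)
  qed
  have unique: "h z = g z" if h: "h \<in> extensions (?C \<times> ?C) ?C ?\<psi>" and z: "z \<in> ?C \<times> ?C" for h z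
  proof -
    from z obtain a b where ab: "a \<in> S" "b \<in> S" "z = (cut a, cut b)" by auto
    have "h z \<in> ?C" using h z by (auto simp: extensions_def OP_def)
    then obtain t where t: "t \<in> S" "h z = cut t" by auto
    have mono: "h x \<le> h y" if "x \<in> ?C \<times> ?C" "y \<in> ?C \<times> ?C" "x \<le> y" for x y
      using h that unfolding extensions_def OP_def monotone_on_def by blast
    have rational: "h (cut (of_rat p), cut (of_rat q)) = cut (of_rat (f p q))"
      if "p \<in> X" "q \<in> X" for p q
    proof -
      let ?z = "(cut (of_rat p), cut (of_rat q))"
      have "?z \<in> dom ?\<psi>" using psi[OF that] by blast
      then have "?\<psi> ?z = Some (h ?z)" using h by (simp only: extensions_def mem_Collect_eq)
      then show ?thesis using psi[OF that] by simp
    qed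
    have lower: "of_rat (f p q) \<le> t" if "p \<in> X" "q \<in> X" "of_rat p \<le> a" "of_rat q \<le> b" for p q
      using mono[of "(cut (of_rat p), cut (of_rat q))" z] that ab t X_S
      by (simp add: rational cut_le_cut_iff)
    have upper: "t \<le> of_rat (f p q)" if "p \<in> X" "q \<in> X" "a \<le> of_rat p" "b \<le> of_rat q" for p q
      using mono[of z "(cut (of_rat p), cut (of_rat q))"] that ab t X_S
      by (simp add: rational cut_le_cut_iff)
    have "t = F a b"
    proof (rule ccontr)
      assume "t \<noteq> F a b"
      then consider "t < F a b" | "F a b < t" by linarith
      then show False
        using below[OF ab(1,2) t(1)] above[OF ab(1,2) t(1)] lower upper by cases force+
    qed
    then show ?thesis using ab t g by simp
  qed
  have "darboux_ext (?C \<times> ?C) ?C ?\<psi> (cut r, cut s) = Some (g (cut r, cut s))"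
    using \<open>r \<in> S\<close> \<open>s \<in> S\<close> by (intro darboux_ext_unique[OF partial ext] unique) auto
  then show ?thesis using \<open>r \<in> S\<close> \<open>s \<in> S\<close> by (simp add: g)
qed

lemma ex_plus_cut: "ex_plus (cut r, cut s) = Some (cut (r + s))"
  unfolding ex_plus_def DR_eq_cuts
proof (rule darboux_ext_cut)
  fix r s t :: real
  assume "t < r + s"
  \<comment> \<open>This range for \<open>p\<close> leaves \<open>t - p < s\<close>, hence room for \<open>q\<close>.\<close>
  then obtain p where p: "t - s < of_rat p" "of_rat p < r" using of_rat_dense[of "t - s" r] by auto
  then obtain q where q: "t - of_rat p < of_rat q" "of_rat q < s"
    using of_rat_dense[of "t - of_rat p" s] by auto
  have "t < of_rat (p + q)" using q by (simp add: of_rat_add)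
  then show "\<exists>p\<in>UNIV. \<exists>q\<in>UNIV. of_rat p \<le> r \<and> of_rat q \<le> s \<and> t < of_rat (p + q)"
    using p q by (meson UNIV_I less_imp_le)
next
  fix r s t :: real
  assume "r + s < t"
  then obtain p where p: "r < of_rat p" "of_rat p < t - s" using of_rat_dense[of r "t - s"] by auto
  then obtain q where q: "s < of_rat q" "of_rat q < t - of_rat p"
    using of_rat_dense[of s "t - of_rat p"] by auto
  have "of_rat (p + q) < t" using q by (simp add: of_rat_add)
  then show "\<exists>p\<in>UNIV. \<exists>q\<in>UNIV. r \<le> of_rat p \<and> s \<le> of_rat q \<and> of_rat (p + q) < t"
    using p q by (meson UNIV_I less_imp_le)
qed (auto simp: yoneda_UNIV of_rat_add)

lemma ex_times_cut:
  assumes "0 < r" "0 < s"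
  shows "ex_times (cut r, cut s) = Some (cut (r * s))"
  unfolding ex_times_def DRpos_eq_cuts
proof (rule darboux_ext_cut)
  fix r s t :: real
  assume pos: "r \<in> {0<..}" "s \<in> {0<..}" "t \<in> {0<..}" and "t < r * s"
  \<comment> \<open>A rational \<open>p\<close> between \<open>t / s\<close> and \<open>r\<close> leaves \<open>t / p < s\<close>, hence room for \<open>q\<close>.\<close>
  then have "t / s < r" by (simp add: field_simps)
  then obtain p where p: "t / s < of_rat p" "of_rat p < r" using of_rat_dense by blast
  have "0 < t / s" using pos by simp
  then have p0: "0 < (of_rat p :: real)" using p(1) by linarith
  then have "t / of_rat p < s" using p pos by (simp add: field_simps)
  then obtain q where q: "t / of_rat p < of_rat q" "of_rat q < s" using of_rat_dense by blast
  have "0 < t / of_rat p" using pos p0 by simp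
  then have q0: "0 < (of_rat q :: real)" using q(1) by linarith
  have "t < of_rat (p * q)" using q(1) p0 by (simp add: of_rat_mult field_simps)
  then show "\<exists>p\<in>Qpos. \<exists>q\<in>Qpos. of_rat p \<le> r \<and> of_rat q \<le> s \<and> t < of_rat (p * q)"
    using p q p0 q0 by (intro bexI[of _ p] bexI[of _ q]) (auto simp: Qpos_iff)
next
  fix r s t :: real
  assume pos: "r \<in> {0<..}" "s \<in> {0<..}" "t \<in> {0<..}" and "r * s < t"
  then have "r < t / s" by (simp add: field_simps)
  then obtain p where p: "r < of_rat p" "of_rat p < t / s" using of_rat_dense by blast
  have p0: "0 < (of_rat p :: real)" using p(1) pos(1) by (metis greaterThan_iff order.strict_trans)
  then have "s < t / of_rat p" using p pos by (simp add: field_simps)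
  then obtain q where q: "s < of_rat q" "of_rat q < t / of_rat p" using of_rat_dense by blast
  have q0: "0 < (of_rat q :: real)" using q(1) pos(2) by (metis greaterThan_iff order.strict_trans)
  have "of_rat (p * q) < t" using q(2) p0 by (simp add: of_rat_mult field_simps)
  then show "\<exists>p\<in>Qpos. \<exists>q\<in>Qpos. r \<le> of_rat p \<and> s \<le> of_rat q \<and> of_rat (p * q) < t"
    using p q p0 q0 by (intro bexI[of _ p] bexI[of _ q]) (auto simp: Qpos_iff)
qed (use assms in \<open>auto simp: yoneda_Qpos Qpos_iff of_rat_mult mult_mono\<close>)

section \<open>The semifield of positive reals\<close>

theorem theorem6p14: "semifield DRpos ex_plus ex_times"
proof -
  have plus: "app2 ex_plus (cut r) (cut s) = cut (r + s)" for r s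
    by (simp add: app2_def ex_plus_cut)
  have times: "app2 ex_times (cut r) (cut s) = cut (r * s)" if "0 < r" "0 < s" for r s
    using that by (simp add: app2_def ex_times_cut)
  let ?G = "\<lparr>carrier = DRpos, mult = app2 ex_times, one = cut 1\<rparr>"
  have "comm_group ?G"
  proof (rule comm_groupI)
    fix x assume "x \<in> carrier ?G"
    then obtain r where "0 < r" "x = cut r" by (auto simp: DRpos_eq_cuts)
    then show "\<exists>y\<in>carrier ?G. y \<otimes>\<^bsub>?G\<^esub> x = \<one>\<^bsub>?G\<^esub>"
      by (intro bexI[of _ "cut (inverse r)"]) (auto simp: times DRpos_eq_cuts)
  qed (auto simp: DRpos_eq_cuts times mult_ac)
  then show ?thesis
    unfolding semifield_def operation_on_def
    by (auto simp: DRpos_eq_cuts plus times ex_plus_cut ex_times_cut add_ac add_pos_pos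
        distrib_left distrib_right)
qed

end
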